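(* For all integers $n\ge d\ge 1$, $\Sigma_{\mathrm{DR}}(d,n)\le (n-d)^{1+\log_2 d}$.
   Context: Let $S=\{1,\dots,n\}$ (the symbol set) and let $\binom{S}{d}$ denote the set of $d$-element subsets of $S$. A $d$-dimensional subset partition graph on $S$ is a connected graph $G=(\mathcal V,E)$ whose vertex set $\mathcal V=\{\mathcal V_1,\dots,\mathcal V_k\}$ is a partition of some set $\mathcal A\subseteq\binom{S}{d}$: the $\mathcal V_i$ are pairwise disjoint, nonempty, and their union is $\mathcal A$. For $F\subseteq S$, the restriction $G_F$ is the graph obtained from $G$ by replacing $\mathcal A$ with $\mathcal A_F=\{A\in\mathcal A: F\subseteq A\}$, removing every vertex $\mathcal V_i$ with $\mathcal V_i\cap\mathcal A_F=\emptyset$ together with its incident edges, and keeping the remaining vertices and edges among them. $G$ satisfies dimension reduction if for every $F\subseteq S$ with $|F|\le d$ the restriction $G_F$ is connected. The diameter of $G$ is the maximum over pairs of vertices of the graph distance between them. $\Sigma_{\mathrm{DR}}(d,n)$ denotes the maximum diameter among $d$-dimensional subset partition graphs on the symbol set $\{1,\dots,n\}$ satisfying dimension reduction. *)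

theory Defs
  imports "Graph_Theory.Graph_Theory" "HOL-Library.Disjoint_Sets"
begin

text \<open>Undirected simple graphs are the finite symmetric loop-free digraphs (\<open>pair_graph\<close>).
  Note that \<open>connected\<close> includes nonemptiness of the vertex set.\<close>

definition subset_partition_graph :: "nat \<Rightarrow> nat \<Rightarrow> nat set set pair_pre_digraph \<Rightarrow> bool" where
  "subset_partition_graph d n G \<longleftrightarrow>
     pair_graph G \<and> Digraph_Component.connected (with_proj G) \<and>
     (\<exists>A. A \<subseteq> {T. T \<subseteq> {1..n} \<and> card T = d} \<and> partition_on A (pverts G))"

definition restriction ::
  "nat set set pair_pre_digraph \<Rightarrow> nat set \<Rightarrow> (nat set set, nat set set \<times> nat set set) pre_digraph" where
  "restriction G F =
     (let A\<^sub>F = {A \<in> \<Union> (pverts G). F \<subseteq> A}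
      in with_proj G \<restriction> {V \<in> pverts G. V \<inter> A\<^sub>F \<noteq> {}})"

text \<open>The restriction may have no vertices at all, namely when no set in the partitioned family
  contains \<open>F\<close>; such an empty restriction counts as connected here.\<close>

definition dimension_reduction :: "nat \<Rightarrow> nat \<Rightarrow> nat set set pair_pre_digraph \<Rightarrow> bool" where
  "dimension_reduction d n G \<longleftrightarrow>
     (\<forall>F. F \<subseteq> {1..n} \<and> card F \<le> d \<longrightarrow>
        verts (restriction G F) = {} \<or> Digraph_Component.connected (restriction G F))"

definition graph_dist :: "'a pair_pre_digraph \<Rightarrow> 'a \<Rightarrow> 'a \<Rightarrow> nat" where
  "graph_dist G u v = (LEAST k. \<exists>p. pre_digraph.awalk (with_proj G) u p v \<and> length p = k)"

definition graph_diameter :: "'a pair_pre_digraph \<Rightarrow> nat" where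
  "graph_diameter G = Max {graph_dist G u v | u v. u \<in> pverts G \<and> v \<in> pverts G}"

definition Sigma_DR :: "nat \<Rightarrow> nat \<Rightarrow> nat" where
  "Sigma_DR d n =
     Max {graph_diameter G | G. subset_partition_graph d n G \<and> dimension_reduction d n G}"

text \<open>The maxima above are taken over finite nonempty sets.\<close>

lemma finite_subset_partition_graphs: "finite {G. subset_partition_graph d n G}"
proof -
  let ?W = "Pow (Pow {1..n})"
  let ?P = "Pow ?W \<times> Pow (?W \<times> ?W)"
  have "G \<in> (\<lambda>(V, E). \<lparr>pverts = V, parcs = E\<rparr>) ` ?P"
    if G: "subset_partition_graph d n G" for G
  proof -
    from G have wf: "pair_wf_digraph G"
      by (simp add: subset_partition_graph_def pair_graph_def pair_digraph_def pair_fin_digraph_def)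
    from G obtain A where A: "A \<subseteq> Pow {1..n}" "partition_on A (pverts G)"
      unfolding subset_partition_graph_def by blast
    then have V: "pverts G \<subseteq> ?W"
      unfolding partition_on_def by blast
    have "parcs G \<subseteq> pverts G \<times> pverts G"
      using pair_wf_digraph.in_arcsD1[OF wf] pair_wf_digraph.in_arcsD2[OF wf] by (intro subrelI) blast
    with V have "parcs G \<subseteq> ?W \<times> ?W" by blast
    with V have "(pverts G, parcs G) \<in> ?P" by blast
    then show ?thesis
      by (rule rev_image_eqI) simp
  qed
  then have "{G. subset_partition_graph d n G} \<subseteq> (\<lambda>(V, E). \<lparr>pverts = V, parcs = E\<rparr>) ` ?P"
    by blast
  moreover have "finite ?P"
    by (intro finite_cartesian_product finite_Pow_iff[THEN iffD2] finite_atLeastAtMost)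
  ultimately show ?thesis
    by (meson finite_imageI finite_subset)
qed

lemma exists_dimension_reduction_graph:
  assumes "d \<le> n"
  shows "\<exists>G. subset_partition_graph d n G \<and> dimension_reduction d n G"
proof -
  define G :: "nat set set pair_pre_digraph" where "G = \<lparr>pverts = {{{1..d}}}, parcs = {}\<rparr>"
  have [simp]: "pverts G = {{{1..d}}}" "parcs G = {}"
    by (auto simp: G_def)
  have conn: "Digraph_Component.connected H"
    if "verts H = {{{1..d}}}" for H :: "(nat set set, nat set set \<times> nat set set) pre_digraph"
    using that by (auto simp: Digraph_Component.connected_def strongly_connected_def
        mk_symmetric_def reachable_def)
  have "subset_partition_graph d n G"
    unfolding subset_partition_graph_def
  proof (intro conjI)
    show "pair_graph G"
      by unfold_locales (auto simp: symmetric_def)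
    show "\<exists>A. A \<subseteq> {T. T \<subseteq> {1..n} \<and> card T = d} \<and> partition_on A (pverts G)"
      using assms by (intro exI[of _ "{{1..d}}"]) (auto simp: partition_on_def)
  qed (simp add: conn)
  moreover have "dimension_reduction d n G"
    unfolding dimension_reduction_def
  proof (intro allI impI)
    fix F :: "nat set"
    have "verts (restriction G F) \<subseteq> {{{1..d}}}"
      by (auto simp: restriction_def Let_def)
    then show "verts (restriction G F) = {} \<or> Digraph_Component.connected (restriction G F)"
      using conn by blast
  qed
  ultimately show ?thesis by blast
qed

end

theory Submission
  imports Defs
begin

text \<open>The layers of sets at distance 0, 1, 2, \<open>\<dots>\<close> from a fixed vertex form a sequence in which,
  by dimension reduction, the layers containing a superset of any given \<open>F\<close> are consecutive. Unlike
  subset partition graphs, such sequences are closed under passing to a run of consecutive layers,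
  so the Kalai--Kleitman argument applies. Take the longest initial and the longest final run that
  use at most half of the symbols. One step beyond, the two runs share a symbol, which is
  therefore active in all layers in between and can be contracted. With \<open>N(d, n)\<close> the maximal number
  of layers this gives \<open>N(d, n) \<le> 2 N(d, \<lfloor>n/2\<rfloor>) + N(d - 1, n - 1)\<close>, where the first term vanishes
  if \<open>n < 2 d\<close>.\<close>

section \<open>Layer families\<close>

text \<open>\<open>S\<close> only has to contain the symbols in use, so it can be shrunk to those of
  a run. Nothing is demanded of \<open>L\<close> from index \<open>l\<close> on, so a run is a mere
  shift of \<open>L\<close>. The last clause is the trace of dimension reduction.\<close>

definition layer_family :: "'a set \<Rightarrow> nat \<Rightarrow> nat \<Rightarrow> (nat \<Rightarrow> 'a set set) \<Rightarrow> bool" where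
  "layer_family S d l L \<longleftrightarrow>
     (\<forall>i<l. L i \<noteq> {} \<and> L i \<subseteq> {T. T \<subseteq> S \<and> card T = d}) \<and>
     (\<forall>i<l. \<forall>j<l. i \<noteq> j \<longrightarrow> L i \<inter> L j = {}) \<and>
     (\<forall>F i j k. i \<le> j \<longrightarrow> j \<le> k \<longrightarrow> k < l \<longrightarrow>
        (\<exists>A\<in>L i. F \<subseteq> A) \<longrightarrow> (\<exists>A\<in>L k. F \<subseteq> A) \<longrightarrow> (\<exists>A\<in>L j. F \<subseteq> A))"

lemma layer_family_layer:
  assumes "layer_family S d l L" "i < l"
  shows "L i \<noteq> {}" "L i \<subseteq> {T. T \<subseteq> S \<and> card T = d}"
  using assms by (simp_all add: layer_family_def)

lemmas layer_family_nonempty = layer_family_layer(1)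

lemma layer_family_subset: "layer_family S d l L \<Longrightarrow> i < l \<Longrightarrow> A \<in> L i \<Longrightarrow> A \<subseteq> S"
  by (drule (1) layer_family_layer(2)) auto

lemma layer_family_card: "layer_family S d l L \<Longrightarrow> i < l \<Longrightarrow> A \<in> L i \<Longrightarrow> card A = d"
  by (drule (1) layer_family_layer(2)) auto

lemma layer_family_disjoint:
  assumes "layer_family S d l L" "i < l" "j < l" "A \<in> L i" "A \<in> L j"
  shows "i = j"
proof -
  have "\<forall>i<l. \<forall>j<l. i \<noteq> j \<longrightarrow> L i \<inter> L j = {}"
    using assms(1) by (simp add: layer_family_def)
  with assms(2-) show ?thesis by blast
qed

lemma layer_family_convex:
  assumes "layer_family S d l L" "i \<le> j" "j \<le> k" "k < l"
    and "A \<in> L i" "F \<subseteq> A" "B \<in> L k" "F \<subseteq> B"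
  shows "\<exists>C\<in>L j. F \<subseteq> C"
proof -
  have "\<forall>F i j k. i \<le> j \<longrightarrow> j \<le> k \<longrightarrow> k < l \<longrightarrow>
      (\<exists>A\<in>L i. F \<subseteq> A) \<longrightarrow> (\<exists>A\<in>L k. F \<subseteq> A) \<longrightarrow> (\<exists>A\<in>L j. F \<subseteq> A)"
    using assms(1) by (simp add: layer_family_def)
  note this[rule_format, OF assms(2-4)]
  then show ?thesis using assms(5-8) by blast
qed

lemma layer_family_dim_le:
  assumes "layer_family S d l L" "finite S" "0 < l"
  shows "d \<le> card S"
proof -
  obtain A where A: "A \<in> L 0"
    using layer_family_nonempty[OF assms(1,3)] by blast
  show ?thesis
    using card_mono[OF assms(2) layer_family_subset[OF assms(1,3) A]]
      layer_family_card[OF assms(1,3) A] by simp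
qed

text \<open>The ground set becomes the set of symbols that the run really uses; a run with few
  symbols thus falls under the induction on the number of symbols.\<close>

lemma layer_family_segment:
  assumes "layer_family S d l L" "a + m \<le> l"
  shows "layer_family (\<Union>i<m. \<Union> (L (a + i))) d m (\<lambda>i. L (a + i))"
  unfolding layer_family_def
proof (intro conjI allI impI)
  fix i assume i: "i < m"
  then show "L (a + i) \<noteq> {}" using layer_family_nonempty[OF assms(1)] assms(2) by simp
  show "L (a + i) \<subseteq> {T. T \<subseteq> (\<Union>i<m. \<Union> (L (a + i))) \<and> card T = d}"
    using i layer_family_card[OF assms(1), of "a + i"] assms(2) by fastforce
next
  fix i j assume "i < m" "j < m" "i \<noteq> j"
  then show "L (a + i) \<inter> L (a + j) = {}"
    using layer_family_disjoint[OF assms(1), of "a + i" "a + j"] assms(2) by auto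
next
  fix F i j k
  assume "i \<le> j" "j \<le> k" "k < m" "\<exists>A\<in>L (a + i). F \<subseteq> A" "\<exists>A\<in>L (a + k). F \<subseteq> A"
  then show "\<exists>A\<in>L (a + j). F \<subseteq> A"
    using layer_family_convex[OF assms(1), of "a + i" "a + j" "a + k"] assms(2) by auto
qed

text \<open>Removing \<open>s\<close> is injective on sets containing \<open>s\<close>, so layers
  stay disjoint; convexity for \<open>F\<close> after contraction is convexity for
  \<open>insert s F\<close> before it.\<close>

lemma layer_family_contract:
  assumes L: "layer_family S d l L" and s: "\<And>i. i < l \<Longrightarrow> \<exists>A\<in>L i. s \<in> A"
  shows "layer_family (S - {s}) (d - 1) l (\<lambda>i. (\<lambda>A. A - {s}) ` {A \<in> L i. s \<in> A})"
  unfolding layer_family_def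
proof (intro conjI allI impI)
  fix i assume i: "i < l"
  then show "(\<lambda>A. A - {s}) ` {A \<in> L i. s \<in> A} \<noteq> {}" using s by blast
  show "(\<lambda>A. A - {s}) ` {A \<in> L i. s \<in> A} \<subseteq> {T. T \<subseteq> S - {s} \<and> card T = d - 1}"
    using layer_family_subset[OF L i] layer_family_card[OF L i]
    by (auto simp: card_Diff_singleton)
next
  fix i j assume ij: "i < l" "j < l" "i \<noteq> j"
  have "A = B" if "s \<in> A" "s \<in> B" "A - {s} = B - {s}" for A B
    using that by blast
  then show "(\<lambda>A. A - {s}) ` {A \<in> L i. s \<in> A} \<inter> (\<lambda>A. A - {s}) ` {A \<in> L j. s \<in> A} = {}"
    using layer_family_disjoint[OF L ij(1,2)] ij(3) by blast
next
  fix F i j k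
  assume ijk: "i \<le> j" "j \<le> k" "k < l"
    and "\<exists>A\<in>(\<lambda>A. A - {s}) ` {A \<in> L i. s \<in> A}. F \<subseteq> A"
    and "\<exists>A\<in>(\<lambda>A. A - {s}) ` {A \<in> L k. s \<in> A}. F \<subseteq> A"
  then obtain A B where AB: "A \<in> L i" "s \<in> A" "F \<subseteq> A - {s}" "B \<in> L k" "s \<in> B" "F \<subseteq> B - {s}"
    by blast
  then obtain C where C: "C \<in> L j" "insert s F \<subseteq> C"
    using layer_family_convex[OF L ijk, of A "insert s F" B] by blast
  then have "C - {s} \<in> (\<lambda>A. A - {s}) ` {A \<in> L j. s \<in> A}" by simp
  moreover have "F \<subseteq> C - {s}" using AB(3) C(2) by blast
  ultimately show "\<exists>A\<in>(\<lambda>A. A - {s}) ` {A \<in> L j. s \<in> A}. F \<subseteq> A" ..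
qed

text \<open>Base case \<open>d = 1\<close> of the length bound, where the exponent is 1:
  representatives of disjoint layers are distinct singletons.\<close>

lemma layer_family_singletons:
  assumes L: "layer_family S 1 l L" and S: "finite S"
  shows "l \<le> card S"
proof -
  define f where "f i = (SOME A. A \<in> L i)" for i
  have f: "f i \<in> L i" if "i < l" for i
    unfolding f_def using layer_family_nonempty[OF L that] by (rule some_in_eq[THEN iffD2])
  have inj: "inj_on f {..<l}"
    using f layer_family_disjoint[OF L] by (intro inj_onI) (metis lessThan_iff)
  have "f ` {..<l} \<subseteq> (\<lambda>x. {x}) ` S"
  proof
    fix A assume "A \<in> f ` {..<l}"
    then obtain i where i: "i < l" "A \<in> L i" using f by auto
    then obtain x where "A = {x}" using layer_family_card[OF L] card_1_singletonE by metis
    then show "A \<in> (\<lambda>x. {x}) ` S" using layer_family_subset[OF L i] by blast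
  qed
  then have "card (f ` {..<l}) \<le> card ((\<lambda>x. {x}) ` S)" by (intro card_mono) (use S in auto)
  then show ?thesis
    using card_image[OF inj] card_image[of "\<lambda>x. {x}" S] by simp
qed

section \<open>The Kalai--Kleitman recursion\<close>

text \<open>Each of \<open>x\<close> and \<open>y\<close> is at most \<open>x + y\<close>, so in
  \<open>z * z powr (a - 1)\<close> the second factor may be enlarged to
  \<open>(x + y) powr (a - 1)\<close>; then add.\<close>

lemma powr_add_superadditive:
  fixes a x y :: real
  assumes "1 \<le> a" "0 \<le> x" "0 \<le> y"
  shows "x powr a + y powr a \<le> (x + y) powr a"
proof (cases "x + y = 0")
  case False
  have *: "z powr a \<le> z * (x + y) powr (a - 1)" if "0 \<le> z" "z \<le> x + y" for z
  proof (cases "z = 0")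
    case False
    have "z powr a = z * z powr (a - 1)"
      using that False by (simp add: powr_diff)
    also have "\<dots> \<le> z * (x + y) powr (a - 1)"
      using that assms by (intro mult_left_mono powr_mono2) auto
    finally show ?thesis .
  qed simp
  have "x powr a + y powr a \<le> (x + y) * (x + y) powr (a - 1)"
    using *[of x] *[of y] assms by (simp add: distrib_right)
  also have "\<dots> = (x + y) powr a"
    using False assms by (simp add: powr_diff)
  finally show ?thesis .
next
  case True
  with assms have "x = 0" "y = 0" by auto
  then show ?thesis by simp
qed

text \<open>Here \<open>m\<close> stands for \<open>n - d\<close>: contraction leaves it unchanged,
  and halving \<open>n\<close> turns it into \<open>(m - d) / 2\<close>. The summand 2 is the
  surplus of three offsets 1 over one. Lowering \<open>d\<close> in the exponent gains at least
  \<open>m powr a / d\<close>; since \<open>2 powr a = 2 * d\<close>, the two halves cost only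
  \<open>(m - d) powr a / d\<close>, and superadditivity with \<open>d powr a \<ge> 2 * d\<close>
  pays for the 2.\<close>

lemma kalai_kleitman_recursion:
  fixes m d :: real
  assumes d: "2 \<le> d" and m: "d \<le> m"
  shows "m powr (1 + log 2 (d - 1)) + 2 * ((m - d) / 2) powr (1 + log 2 d) + 2 \<le> m powr (1 + log 2 d)"
proof -
  define a where "a = 1 + log 2 d"
  have a: "2 \<le> a" unfolding a_def using d by (simp add: le_log_iff)
  have half: "2 * ((m - d) / 2) powr a = (m - d) powr a / d"
  proof -
    have "2 powr a = 2 * d" unfolding a_def using d by (simp add: powr_add)
    then show ?thesis using d m by (simp add: powr_divide)
  qed
  have "m powr (1 + log 2 (d - 1)) = m powr a * m powr log 2 ((d - 1) / d)"
    unfolding a_def using d by (simp add: powr_add[symmetric] log_divide)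
  \<comment> \<open>The exponent is negative and \<open>m\<close> is at least 2.\<close>
  also have "\<dots> \<le> m powr a * 2 powr log 2 ((d - 1) / d)"
    using d m by (intro mult_left_mono powr_mono2') (auto simp: divide_simps)
  also have "\<dots> = m powr a * ((d - 1) / d)"
    using d by simp
  finally have first: "m powr (1 + log 2 (d - 1)) \<le> m powr a - m powr a / d"
    using d by (simp add: field_simps)
  have "2 * d \<le> d powr 2" using d by (simp add: power2_eq_square)
  also have "\<dots> \<le> d powr a" using a d by (intro powr_mono) auto
  finally have "(m - d) powr a + 2 * d \<le> m powr a"
    using powr_add_superadditive[of a "m - d" d] a d m by simp
  then have "((m - d) powr a + 2 * d) / d \<le> m powr a / d"
    using d by (intro divide_right_mono) auto
  then have "(m - d) powr a / d + 2 \<le> m powr a / d"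
    using d by (simp add: add_divide_distrib)
  with first half show ?thesis unfolding a_def by linarith
qed

lemma large_subsets_meet:
  assumes "finite S" "U \<subseteq> S" "W \<subseteq> S" "card S < card U + card W"
  obtains s where "s \<in> U" "s \<in> W"
proof -
  have "card (U \<union> W) \<le> card S" using assms(1-3) by (intro card_mono) auto
  moreover have "finite U" "finite W" using assms(1-3) finite_subset by auto
  ultimately have "U \<inter> W \<noteq> {}" using card_Un_disjoint[of U W] assms(4) by linarith
  then show ?thesis using that by blast
qed

lemma maximal_run:
  fixes P :: "nat \<Rightarrow> bool"
  assumes "P 0"
  obtains i where "i \<le> l" "P i" "i < l \<Longrightarrow> \<not> P (Suc i)"
proof -
  define i where "i = Max {i. i \<le> l \<and> P i}"
  have fin: "finite {i. i \<le> l \<and> P i}" by simp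
  then have "i \<in> {i. i \<le> l \<and> P i}"
    unfolding i_def by (rule Max_in) (use assms in auto)
  moreover have "\<not> P (Suc i)" if "i < l"
    using Max_ge[OF fin, of "Suc i"] that unfolding i_def[symmetric] by auto
  ultimately show ?thesis using that by blast
qed

text \<open>The offset 1 counts layer 0. Strong induction on \<open>card S\<close> with
  \<open>d\<close> arbitrary serves both the two end runs (same \<open>d\<close>) and the contracted
  middle (\<open>d - 1\<close>).\<close>

theorem layer_family_length:
  assumes "layer_family S d l L" "finite S" "1 \<le> d"
  shows "real l \<le> 1 + (real (card S) - real d) powr (1 + log 2 (real d))"
  using assms
proof (induction "card S" arbitrary: S d l L rule: less_induct)
  case less
  note L = \<open>layer_family S d l L\<close>
  let ?n = "card S" and ?a = "1 + log 2 (real d)"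
  let ?m = "real ?n - real d"
  let ?run = "\<lambda>a m. \<Union>i<m. \<Union> (L (a + i))"
  consider "l = 0" | "0 < l" "d = 1" | "0 < l" "2 \<le> d"
    using \<open>1 \<le> d\<close> by linarith
  then show ?case
  proof cases
    case 1
    then show ?thesis by simp
  next
    case 2
    then have "l \<le> ?n" using L layer_family_singletons \<open>finite S\<close> by blast
    with 2 show ?thesis by simp
  next
    case 3
    have dn: "d \<le> ?n" using layer_family_dim_le[OF L \<open>finite S\<close> 3(1)] .
    have run_sub: "?run a m \<subseteq> S" if "a + m \<le> l" for a m
      using that by (intro UN_least Union_least layer_family_subset[OF L]) auto
    \<comment> \<open>A nonempty run uses at least \<open>d\<close> symbols, so it fits into half of
      them only if \<open>2 * d \<le> ?n\<close>; otherwise \<open>m = 0\<close>, whence the default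
      0. The base \<open>(?m - real d) / 2\<close> is \<open>?n / 2 - d\<close>.\<close>
    have short: "real m \<le> (if 2 * d \<le> ?n then 1 + ((?m - real d) / 2) powr ?a else 0)"
      if am: "a + m \<le> l" and small: "2 * card (?run a m) \<le> ?n" for a m
    proof (cases "m = 0")
      case False
      have fam: "layer_family (?run a m) d m (\<lambda>i. L (a + i))"
        using layer_family_segment[OF L am] .
      have fin: "finite (?run a m)" using run_sub[OF am] \<open>finite S\<close> finite_subset by blast
      have le: "d \<le> card (?run a m)" using layer_family_dim_le[OF fam fin] False by simp
      have "card (?run a m) < ?n" using small dn 3(2) by linarith
      then have "real m \<le> 1 + (real (card (?run a m)) - real d) powr ?a"
        using less.hyps fam fin \<open>1 \<le> d\<close> by blast
      also have "\<dots> \<le> 1 + ((?m - real d) / 2) powr ?a"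
      proof -
        have "0 \<le> log 2 (real d)" using 3(2) by simp
        moreover have "real (card (?run a m)) - real d \<le> (?m - real d) / 2"
          using small by (simp add: field_simps)
        ultimately have "(real (card (?run a m)) - real d) powr ?a \<le> ((?m - real d) / 2) powr ?a"
          using le by (intro powr_mono2) (auto simp del: diff_le_eq)
        then show ?thesis by simp
      qed
      finally show ?thesis using le small by auto
    qed auto
    obtain i where i: "i \<le> l" "2 * card (?run 0 i) \<le> ?n"
        "i < l \<Longrightarrow> \<not> 2 * card (?run 0 (Suc i)) \<le> ?n"
      using maximal_run[of "\<lambda>i. 2 * card (?run 0 i) \<le> ?n" l] by auto
    obtain j where j: "j \<le> l" "2 * card (?run (l - j) j) \<le> ?n"
        "j < l \<Longrightarrow> \<not> 2 * card (?run (l - Suc j) (Suc j)) \<le> ?n"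
      using maximal_run[of "\<lambda>j. 2 * card (?run (l - j) j) \<le> ?n" l] by auto
    have middle: "real (l - i - j) \<le> 1 + ?m powr (1 + log 2 (real d - 1))"
    proof (cases "i + j < l")
      case True
      let ?U = "?run 0 (Suc i)" and ?W = "?run (l - Suc j) (Suc j)"
      have sub: "?U \<subseteq> S" "?W \<subseteq> S"
        using run_sub[of 0 "Suc i"] run_sub[of "l - Suc j" "Suc j"] True by auto
      have "?n < card ?U + card ?W" using i(3) j(3) True by linarith
      then obtain s where s: "s \<in> ?U" "s \<in> ?W"
        using large_subsets_meet[OF \<open>finite S\<close> sub] by blast
      from s(1) obtain p A where p: "p \<le> i" "A \<in> L p" "s \<in> A" by (auto simp: less_Suc_eq_le)
      from s(2) obtain q B where q: "q < Suc j" "B \<in> L (l - Suc j + q)" "s \<in> B" by blast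
      \<comment> \<open>The middle consists of the layers \<open>i\<close> to
        \<open>l - Suc j\<close>, and \<open>s\<close> occurs in layer \<open>p \<le> i\<close> and
        in layer \<open>l - Suc j + q\<close>, so convexity for \<open>{s}\<close> covers
        it.\<close>
      have active: "\<exists>C\<in>L (i + c). s \<in> C" if "c < l - i - j" for c
        using layer_family_convex[OF L, of p "i + c" "l - Suc j + q" A "{s}" B] p q that True
        by auto
      let ?R = "?run i (l - i - j)"
      have le: "i + (l - i - j) \<le> l" using True by simp
      have fam: "layer_family (?R - {s}) (d - 1) (l - i - j)
          (\<lambda>c. (\<lambda>A. A - {s}) ` {A \<in> L (i + c). s \<in> A})"
        by (rule layer_family_contract[OF layer_family_segment[OF L le] active])
      have R_sub: "?R - {s} \<subset> S"
      proof -
        have "s \<in> S" using s(1) sub(1) by (rule rev_subsetD)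
        then show ?thesis using run_sub[OF le] by auto
      qed
      note R = psubset_card_mono[OF \<open>finite S\<close> R_sub]
        finite_subset[OF psubset_imp_subset[OF R_sub] \<open>finite S\<close>]
      have *: "real (l - i - j)
          \<le> 1 + (real (card (?R - {s})) - real (d - 1)) powr (1 + log 2 (real (d - 1)))"
        by (rule less.hyps[OF R(1) fam R(2)]) (use 3(2) in simp)
      have "d - 1 \<le> card (?R - {s})"
        by (rule layer_family_dim_le[OF fam R(2)]) (use True in simp)
      \<comment> \<open>At most \<open>?n - 1\<close> symbols remain and the dimension is
        \<open>d - 1\<close>, so the difference is still at most \<open>?m\<close>.\<close>
      have "(real (card (?R - {s})) - real (d - 1)) powr (1 + log 2 (real (d - 1)))
          \<le> ?m powr (1 + log 2 (real (d - 1)))"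
        using \<open>d - 1 \<le> card (?R - {s})\<close> R(1) 3(2) by (intro powr_mono2) auto
      then show ?thesis using * 3(2) by (simp add: of_nat_diff)
    qed simp
    \<comment> \<open>Only an inequality: if the end runs overlap, the truncated difference is
      0.\<close>
    have sum: "real l \<le> real i + real j + real (l - i - j)" by linarith
    note ends = short[of 0 i] short[of "l - j" j]
    show ?thesis
    proof (cases "2 * d \<le> ?n")
      case True
      have ij: "real i \<le> 1 + ((?m - real d) / 2) powr ?a" "real j \<le> 1 + ((?m - real d) / 2) powr ?a"
        using ends i(1,2) j(1,2) True by simp_all
      have "real l \<le> 2 * (1 + ((?m - real d) / 2) powr ?a) + (1 + ?m powr (1 + log 2 (real d - 1)))"
        using add_mono[OF add_mono[OF ij] middle] sum unfolding mult_2 by (rule order_trans[rotated])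
      also have "\<dots> \<le> 1 + ?m powr ?a"
      proof -
        have "2 \<le> real d" "real d \<le> ?m" using 3(2) True by linarith+
        note kalai_kleitman_recursion[OF this]
        moreover have "2 * (1 + X) + (1 + Y) \<le> 1 + Z" if "Y + 2 * X + 2 \<le> Z" for X Y Z :: real
          using that by simp
        ultimately show ?thesis by blast
      qed
      finally show ?thesis .
    next
      \<comment> \<open>Now both end runs are empty, so the middle is the whole family.\<close>
      case False
      then have "real l \<le> 1 + ?m powr (1 + log 2 (real d - 1))"
        using ends i(1,2) j(1,2) middle sum by simp
      moreover have "?m powr (1 + log 2 (real d - 1)) \<le> ?m powr ?a"
      \<comment> \<open>Monotonicity in the exponent needs base at least 1; for
        \<open>?n = d\<close> the base is 0 and both powers vanish.\<close>
      proof (cases "?n = d")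
        case False
        then show ?thesis using dn 3(2) by (intro powr_mono) auto
      qed simp
      ultimately show ?thesis by linarith
    qed
  qed
qed

section \<open>Distance layers of a subset partition graph\<close>

lemma graph_dist_self:
  assumes "pair_graph G" "u \<in> pverts G"
  shows "graph_dist G u u = 0"
proof -
  interpret pair_graph G by fact
  have "awalk u [] u" using assms(2) by (simp add: awalk_Nil_iff)
  then show ?thesis unfolding graph_dist_def by (intro Least_eq_0 exI[of _ "[]"]) simp
qed

text \<open>Append the arc to a shortest walk. Such a walk exists because arcs are symmetric, so
  reachability in the symmetric closure is reachability in \<open>G\<close>.\<close>

lemma graph_dist_arc:
  assumes "pair_graph G" "Digraph_Component.connected (with_proj G)"
    and "u \<in> pverts G" "(x, y) \<in> parcs G"
  shows "graph_dist G u y \<le> Suc (graph_dist G u x)"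
proof -
  interpret pair_graph G by fact
  have "x \<in> pverts G" using in_arcsD1[OF assms(4)] .
  with assms(2,3) have "u \<rightarrow>\<^sup>*\<^bsub>with_proj (mk_symmetric (with_proj G))\<^esub> x"
    by (auto simp: Digraph_Component.connected_def strongly_connected_def mk_symmetric_def)
  then have "\<exists>k p. awalk u p x \<and> length p = k"
    using reachable_mk_symmetric_eq[OF pair_sym_arcs] by (simp add: reachable_awalk)
  then have "\<exists>p. awalk u p x \<and> length p = graph_dist G u x"
    unfolding graph_dist_def by (rule LeastI_ex)
  then obtain p where p: "awalk u p x" "length p = graph_dist G u x" by blast
  have "awalk x [(x, y)] y" using arc_implies_awalk[OF assms(4)] by simp
  then have "awalk u (p @ [(x, y)]) y" using awalk_appendI[OF p(1)] by blast
  then have "\<exists>p'. awalk u p' y \<and> length p' = Suc (graph_dist G u x)"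
    using p(2) by (intro exI[of _ "p @ [(x, y)]"]) auto
  then show ?thesis unfolding graph_dist_def[of G u y] by (rule Least_le)
qed

text \<open>Along a path inside \<open>W\<close> from \<open>x\<close> to \<open>z\<close>,
  \<open>f\<close> climbs by at most one per arc and so cannot jump over \<open>j\<close>.\<close>

lemma connected_intermediate_value:
  fixes f :: "'a \<Rightarrow> nat"
  assumes G: "pair_graph G" and conn: "Digraph_Component.connected (with_proj G \<restriction> W)"
    and f: "\<And>x y. (x, y) \<in> parcs G \<Longrightarrow> f y \<le> Suc (f x)"
    and "x \<in> W" "z \<in> W" "f x \<le> j" "j \<le> f z"
  shows "\<exists>y\<in>W. f y = j"
proof -
  interpret pair_graph G by fact
  let ?H = "mk_symmetric (with_proj G \<restriction> W)"
  have "x \<rightarrow>\<^sup>*\<^bsub>?H\<^esub> z"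
    using conn \<open>x \<in> W\<close> \<open>z \<in> W\<close>
    by (auto simp: Digraph_Component.connected_def strongly_connected_def mk_symmetric_def)
  then have "(x, z) \<in> rtrancl_on W (parcs ?H)"
    by (simp add: reachable_def mk_symmetric_def)
  \<comment> \<open>The premise is part of the induction claim, since \<open>f\<close> may still be
    below \<open>j\<close> at an intermediate vertex.\<close>
  then have "j \<le> f z \<longrightarrow> (\<exists>y\<in>W. f y = j)"
  proof (induction rule: rtrancl_on_induct)
    case base
    with \<open>f x \<le> j\<close> show ?case by force
  next
    case (step y z)
    have "(y, z) \<in> parcs G"
      using step.hyps(2) pair_sym_arcs by (auto simp: mk_symmetric_def symmetric_def dest: symD)
    then have "f z \<le> Suc (f y)" by (rule f)
    with step show ?case by (metis le_SucE le_trans order_antisym)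
  qed
  with \<open>j \<le> f z\<close> show ?thesis by blast
qed

text \<open>The vertices having a member that contains \<open>F\<close> induce a connected
  restriction, so their distances from \<open>u\<close> leave no gap.\<close>

lemma distance_layers:
  assumes G: "subset_partition_graph d n G" and DR: "dimension_reduction d n G"
    and u: "u \<in> pverts G" and v: "v \<in> pverts G"
  shows "layer_family {1..n} d (Suc (graph_dist G u v))
           (\<lambda>i. \<Union> {V \<in> pverts G. graph_dist G u V = i})"
proof -
  let ?f = "graph_dist G u"
  let ?L = "\<lambda>i. \<Union> {V \<in> pverts G. ?f V = i}"
  have pg: "pair_graph G" and conn: "Digraph_Component.connected (with_proj G)"
    using G unfolding subset_partition_graph_def by auto
  obtain \<A> where \<A>: "\<A> \<subseteq> {T. T \<subseteq> {1..n} \<and> card T = d}" "partition_on \<A> (pverts G)"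
    using G unfolding subset_partition_graph_def by blast
  have ne: "{} \<notin> pverts G" and disj: "disjoint (pverts G)" and U: "\<Union> (pverts G) = \<A>"
    using \<A>(2) by (auto simp: partition_on_def)
  have convex: "\<exists>A\<in>?L j. F \<subseteq> A"
    if ijk: "i \<le> j" "j \<le> k" and i: "\<exists>A\<in>?L i. F \<subseteq> A" and k: "\<exists>A\<in>?L k. F \<subseteq> A" for F i j k
  proof -
    obtain V A where V: "V \<in> pverts G" "?f V = i" "A \<in> V" "F \<subseteq> A" using i by blast
    obtain W B where W: "W \<in> pverts G" "?f W = k" "B \<in> W" "F \<subseteq> B" using k by blast
    have "A \<in> \<A>" using V U by blast
    then have A: "A \<subseteq> {1..n}" "card A = d" using \<A>(1) by auto
    \<comment> \<open>Lying inside a member of the family makes \<open>F\<close> admissible for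
      dimension reduction.\<close>
    have "card F \<le> d" "F \<subseteq> {1..n}"
      using card_mono[of A F] V(4) A finite_subset[OF A(1)] by auto
    define R where "R = {V \<in> pverts G. V \<inter> {A \<in> \<Union> (pverts G). F \<subseteq> A} \<noteq> {}}"
    have R: "V \<in> R" "W \<in> R" unfolding R_def using V W by blast+
    have restr: "restriction G F = with_proj G \<restriction> R"
      by (simp only: restriction_def R_def Let_def)
    have "verts (restriction G F) = {} \<or> Digraph_Component.connected (restriction G F)"
      using DR \<open>card F \<le> d\<close> \<open>F \<subseteq> {1..n}\<close> by (simp only: dimension_reduction_def)
    \<comment> \<open>The vertex \<open>V\<close> excludes the alternative of an empty
      restriction.\<close>
    then have R_conn: "Digraph_Component.connected (with_proj G \<restriction> R)"
      unfolding restr induce_subgraph_verts using R(1) by fast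
    have "\<exists>X\<in>R. ?f X = j"
      using connected_intermediate_value[of G R ?f V W j] pg R_conn graph_dist_arc[OF pg conn u] R
        V(2) W(2) ijk by simp
    then show ?thesis unfolding R_def by blast
  qed
  \<comment> \<open>Nonemptiness of all layers up to \<open>?f v\<close> is convexity for
    \<open>F = {}\<close> between the layers of \<open>u\<close> and \<open>v\<close>.\<close>
  have L_ne: "\<exists>A\<in>?L (?f V). {} \<subseteq> A" if "V \<in> pverts G" for V
  proof -
    have "V \<noteq> {}" using that ne by metis
    then show ?thesis using that by blast
  qed
  show ?thesis
    unfolding layer_family_def
  proof (intro conjI allI impI)
    fix i assume "i < Suc (?f v)"
    then have "\<exists>A\<in>?L i. {} \<subseteq> A"
      using convex[OF _ _ L_ne[OF u] L_ne[OF v], of i] graph_dist_self[OF pg u] by simp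
    then show "?L i \<noteq> {}" by blast
    show "?L i \<subseteq> {T. T \<subseteq> {1..n} \<and> card T = d}" using U \<A>(1) by blast
  next
    fix i j :: nat assume "i \<noteq> j"
    then show "?L i \<inter> ?L j = {}" using disj by (fastforce simp: disjoint_def)
  next
    fix F i j k
    assume "i \<le> j" "j \<le> k" "\<exists>A\<in>?L i. F \<subseteq> A" "\<exists>A\<in>?L k. F \<subseteq> A"
    then show "\<exists>A\<in>?L j. F \<subseteq> A" by (rule convex)
  qed
qed

section \<open>From distances to the diameter and its maximum\<close>

lemma graph_diameter_attained:
  assumes "finite (pverts G)" "pverts G \<noteq> {}"
  obtains u v where "u \<in> pverts G" "v \<in> pverts G" "graph_diameter G = graph_dist G u v"
proof -
  let ?D = "{graph_dist G u v | u v. u \<in> pverts G \<and> v \<in> pverts G}"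
  have "?D = (\<lambda>(u, v). graph_dist G u v) ` (pverts G \<times> pverts G)" by auto
  then have "finite ?D" using assms(1) by simp
  moreover have "?D \<noteq> {}" using assms(2) by blast
  ultimately have "graph_diameter G \<in> ?D" unfolding graph_diameter_def by (rule Max_in)
  then show ?thesis using that by blast
qed

lemma Sigma_DR_attained:
  assumes "d \<le> n"
  obtains G where "subset_partition_graph d n G" "dimension_reduction d n G"
    "Sigma_DR d n = graph_diameter G"
proof -
  let ?D = "{graph_diameter G | G. subset_partition_graph d n G \<and> dimension_reduction d n G}"
  have "?D \<subseteq> graph_diameter ` {G. subset_partition_graph d n G}" by blast
  then have "finite ?D" by (meson finite_subset_partition_graphs finite_imageI finite_subset)
  moreover have "?D \<noteq> {}" using exists_dimension_reduction_graph[OF assms] by blast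
  ultimately have "Sigma_DR d n \<in> ?D" unfolding Sigma_DR_def by (rule Max_in)
  then show ?thesis using that by blast
qed

theorem theorem3:
  fixes n d :: nat
  assumes "1 \<le> d" and "d \<le> n"
  shows "real (Sigma_DR d n) \<le> (real n - real d) powr (1 + log 2 (real d))"
proof -
  obtain G where G: "subset_partition_graph d n G" "dimension_reduction d n G"
      "Sigma_DR d n = graph_diameter G"
    using Sigma_DR_attained[OF assms(2)] .
  then have pg: "pair_graph G" and "Digraph_Component.connected (with_proj G)"
    unfolding subset_partition_graph_def by auto
  then have "pverts G \<noteq> {}"
    by (auto simp: Digraph_Component.connected_def strongly_connected_def mk_symmetric_def)
  moreover have "finite (pverts G)"
    using pg by (simp add: pair_graph_def pair_digraph_def pair_fin_digraph.pair_finite_verts)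
  ultimately obtain u v where "u \<in> pverts G" "v \<in> pverts G" "graph_diameter G = graph_dist G u v"
    using graph_diameter_attained by blast
  \<comment> \<open>There is one more layer than the distance, which cancels the offset 1 of the
    length bound.\<close>
  then show ?thesis
    using layer_family_length[OF distance_layers[OF G(1,2)], of u v] assms(1) G(3) by simp
qed

end
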